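(* Let $X$ be a real Hilbert space and let $J:X\to\mathbb{R}$ be a sequentially weakly upper semicontinuous $C^1$ functional with Lipschitzian derivative. Let $L>0$ be the Lipschitz constant of $J'$. Then, for each $x_0\in X$ with $J'(x_0)\neq 0$, if we set $$\alpha_0=\inf_{x\in M_{1/L}}J(x)\qquad\text{and}\qquad \beta_0=\operatorname{dist}(x_0,M_{1/L}),$$ where $M_{1/L}$ is the (possibly empty) set of all global minima in $X$ of the functional $x\mapsto \frac{1}{2}\|x-x_0\|^2-\frac{1}{L}J(x)$, we have $\alpha_0>J(x_0)$, $\beta_0>0$, and the following properties hold: (i) for every $r\in\,]J(x_0),\alpha_0[$ there exists a unique $y_r\in J^{-1}(r)$ such that $\|x_0-y_r\|=\operatorname{dist}(x_0,J^{-1}(r))$; (ii) for every $r\in\,]0,\beta_0[$ the restriction of the functional $J$ to the set $S(x_0,r)$ has a unique global maximum (i.e. there is exactly one point of $S(x_0,r)$ at which $J|_{S(x_0,r)}$ attains its maximum).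
   Context: For $x_0\in X$ and $r>0$, $S(x_0,r)=\{x\in X:\|x-x_0\|=r\}$. For a set $A\subseteq X$, $\operatorname{dist}(x_0,A)=\inf_{x\in A}\|x_0-x\|$. Convention: $\inf\emptyset=+\infty$; thus if $M_{1/L}=\emptyset$ then $\alpha_0=\beta_0=+\infty$. "Global minima" of a functional means the points at which it attains its infimum over $X$. $]a,b[$ denotes the open interval with endpoints $a,b$ ($b$ possibly $+\infty$). $J$ is $C^1$ in the Fréchet sense, and its derivative $J'$ is regarded as a map $X\to X$ by identifying $X$ with its dual; the Lipschitz constant is with respect to the norm of $X$. *)

theory Defs
  imports "HOL-Analysis.Analysis"
begin

definition weakly_tendsto :: "(nat \<Rightarrow> 'a::real_normed_vector) \<Rightarrow> 'a \<Rightarrow> bool" where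
  "weakly_tendsto u x \<longleftrightarrow>
     (\<forall>f :: 'a \<Rightarrow> real. bounded_linear f \<longrightarrow> (\<lambda>n. f (u n)) \<longlonglongrightarrow> f x)"

definition seq_weakly_usc :: "('a::real_normed_vector \<Rightarrow> real) \<Rightarrow> bool" where
  "seq_weakly_usc J \<longleftrightarrow>
     (\<forall>u x. weakly_tendsto u x \<longrightarrow> limsup (\<lambda>n. ereal (J (u n))) \<le> ereal (J x))"

(* The least constant; only meaningful for a Lipschitz map, since the infimum of the
   empty set of reals is unspecified. *)
definition lipschitz_constant :: "('a::metric_space \<Rightarrow> 'b::metric_space) \<Rightarrow> real" where
  "lipschitz_constant f = Inf {C. C-lipschitz_on UNIV f}"

definition global_minima :: "('a \<Rightarrow> real) \<Rightarrow> 'a set" where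
  "global_minima f = {x. \<forall>y. f x \<le> f y}"

(* Valued in ereal so that the distance to the empty set is infinity; the library's
   infdist would give 0. *)
definition edist_set :: "'a::real_normed_vector \<Rightarrow> 'a set \<Rightarrow> ereal" where
  "edist_set x A = (INF y\<in>A. ereal (norm (x - y)))"

end

theory Submission imports Defs begin

text \<open>
  Fix \<open>x0\<close> and penalize the displacement: for \<open>\<tau> \<ge> 0\<close> let
  \<open>\<Phi>\<^sub>\<tau> x = \<parallel>x - x0\<parallel>\<^sup>2 / 2 - \<tau> * J x\<close>. A global minimizer \<open>b\<close> of \<open>\<Phi>\<^sub>\<tau>\<close> with \<open>\<tau> > 0\<close> solves two
  constrained problems at once: among the points at the same level of \<open>J\<close> it is nearest to \<open>x0\<close>,
  and among the points at the same distance from \<open>x0\<close> it has the largest value of \<open>J\<close>. If the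
  minimizer is unique, so are both constrained optima. The theorem thus amounts to showing that
  unique minimizers of penalized functionals reach every admissible level and every admissible
  radius.

  For \<open>\<tau> < 1/L\<close> the critical points of \<open>\<Phi>\<^sub>\<tau>\<close> are the fixed points of the contraction
  \<open>x \<mapsto> x0 + \<tau> J'(x)\<close>, so there is exactly one, \<open>branch \<tau>\<close>. The quadratic upper bound for \<open>J\<close> implied
  by the Lipschitz gradient makes it the unique global minimizer (\<open>penalized_gap\<close>). The curve
  \<open>branch\<close> is continuous and starts at \<open>x0\<close>, so by the intermediate value theorem only the
  behaviour of \<open>J\<close> and of the distance to \<open>x0\<close> along the curve as \<open>\<tau>\<close> tends to \<open>1/L\<close> matters.

  Here there is an alternative (\<open>branch_unbounded_or_limit\<close>). The distance to \<open>x0\<close> grows along the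
  curve so regularly that, if it stays bounded, the curve is Cauchy; its limit is then a critical
  point, hence a global minimizer, of \<open>\<Phi>\<^sub>1\<^sub>/\<^sub>L\<close>, that is, a point of \<open>M\<close>, so the curve comes
  arbitrarily close to the value \<open>\<alpha>0\<close> of \<open>J\<close> and to the distance \<open>\<beta>0\<close>, or beyond. If the distance is
  unbounded, every radius is exceeded, and so is every level: minimality gives
  \<open>\<Phi>\<^sub>\<tau> (branch \<tau>) \<le> \<Phi>\<^sub>\<tau> x0\<close>, which is impossible at large distance unless \<open>J\<close> is large
  too. Finally, minimizers for a larger \<open>\<tau>\<close> have at least the same \<open>J\<close> and at least the same
  distance, so any single \<open>branch \<tau>\<close> with \<open>0 < \<tau> < 1/L\<close> separates \<open>x0\<close> from \<open>M\<close>: it differs from \<open>x0\<close>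
  because \<open>J' x0 \<noteq> 0\<close>, and then also has a larger value of \<open>J\<close>. This gives \<open>\<alpha>0 > J x0\<close> and
  \<open>\<beta>0 > 0\<close>.
\<close>

section \<open>Distances to sets and the best Lipschitz constant\<close>

lemma lipschitz_on_lipschitz_constant:
  fixes f :: "'a::metric_space \<Rightarrow> 'b::metric_space"
  assumes "C-lipschitz_on UNIV f"
  shows "(lipschitz_constant f)-lipschitz_on UNIV f"
proof (rule lipschitz_onI)
  let ?S = "{C. C-lipschitz_on UNIV f}"
  have ne: "?S \<noteq> {}" using assms by blast
  show "0 \<le> lipschitz_constant f"
    unfolding lipschitz_constant_def by (rule cInf_greatest[OF ne]) (auto dest: lipschitz_on_nonneg)
  fix x y :: 'a
  show "dist (f x) (f y) \<le> lipschitz_constant f * dist x y"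
  proof (cases "x = y")
    case False
    then have "dist x y > 0" by simp
    have "dist (f x) (f y) / dist x y \<le> Inf ?S"
    proof (rule cInf_greatest[OF ne])
      fix C assume "C \<in> ?S"
      then have "dist (f x) (f y) \<le> C * dist x y" by (auto dest: lipschitz_onD)
      with \<open>dist x y > 0\<close> show "dist (f x) (f y) / dist x y \<le> C" by (simp add: divide_le_eq)
    qed
    with \<open>dist x y > 0\<close> show ?thesis
      unfolding lipschitz_constant_def by (simp add: divide_le_eq)
  qed simp
qed

lemma edist_set_attained_iff:
  assumes "y \<in> A"
  shows "ereal (norm (x - y)) = edist_set x A \<longleftrightarrow> (\<forall>z\<in>A. norm (x - y) \<le> norm (x - z))"
proof -
  have "edist_set x A \<le> ereal (norm (x - y))"
    unfolding edist_set_def by (rule INF_lower[OF assms])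
  then have "ereal (norm (x - y)) = edist_set x A \<longleftrightarrow> ereal (norm (x - y)) \<le> edist_set x A"
    by auto
  also have "\<dots> \<longleftrightarrow> (\<forall>z\<in>A. norm (x - y) \<le> norm (x - z))"
    unfolding edist_set_def by (simp add: le_INF_iff)
  finally show ?thesis .
qed

section \<open>Functionals with Lipschitz gradient\<close>

locale lipschitz_gradient =
  fixes J :: "'a::{real_inner, complete_space} \<Rightarrow> real"
    and J' :: "'a \<Rightarrow> 'a"
    and L :: real
    and x0 :: 'a
  assumes gderiv: "GDERIV J x :> J' x"
    and lipschitz: "L-lipschitz_on UNIV J'"
    and L_pos: "L > 0"
begin

lemma gradient_lipschitz: "norm (J' x - J' y) \<le> L * norm (x - y)"
  using lipschitz_onD[OF lipschitz, of x y] by (simp add: dist_norm)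

lemma gradient_inner_le: "inner (J' x - J' y) (x - y) \<le> L * (norm (x - y))\<^sup>2"
proof -
  have "inner (J' x - J' y) (x - y) \<le> norm (J' x - J' y) * norm (x - y)"
    by (rule norm_cauchy_schwarz)
  also have "\<dots> \<le> L * norm (x - y) * norm (x - y)"
    by (intro mult_right_mono gradient_lipschitz) simp
  finally show ?thesis by (simp add: power2_eq_square mult.assoc)
qed

lemma continuous_on_J: "continuous_on S J"
  using gderiv unfolding gderiv_def
  by (intro continuous_at_imp_continuous_on ballI has_derivative_continuous) blast

lemma continuous_on_gradient: "continuous_on S J'"
  using lipschitz_on_continuous_on[OF lipschitz] continuous_on_subset by blast

text \<open>Along the segment from \<open>x\<close> to \<open>y\<close>, the difference between \<open>J\<close> and the claimed quadratic bound
  has derivative at most zero, because the gradient has moved by at most \<open>L * t * \<parallel>y - x\<parallel>\<close> at time \<open>t\<close>.\<close>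

lemma quadratic_upper_bound: "J y \<le> J x + inner (J' x) (y - x) + L / 2 * (norm (y - x))\<^sup>2"
proof -
  define d where "d = y - x"
  define g where "g t = J (x + t *\<^sub>R d) - t * inner (J' x) d - t\<^sup>2 * (L / 2 * (norm d)\<^sup>2)" for t
  have deriv: "DERIV g t :> inner (J' (x + t *\<^sub>R d) - J' x) d - L * t * (norm d)\<^sup>2" for t
  proof -
    have "((\<lambda>t. J (x + t *\<^sub>R d)) has_derivative (\<lambda>h. inner (h *\<^sub>R d) (J' (x + t *\<^sub>R d)))) (at t)"
      by (rule has_derivative_compose[of "\<lambda>t. x + t *\<^sub>R d" "\<lambda>h. h *\<^sub>R d" t UNIV J])
         (auto intro!: derivative_eq_intros gderiv[unfolded gderiv_def])
    then have "DERIV (\<lambda>t. J (x + t *\<^sub>R d)) t :> inner (J' (x + t *\<^sub>R d)) d"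
      by (rule has_derivative_imp_has_field_derivative) (simp add: inner_commute)
    then show ?thesis
      unfolding g_def by (auto intro!: derivative_eq_intros simp: inner_diff_left)
  qed
  have "g 1 \<le> g 0"
  proof (rule DERIV_nonpos_imp_nonincreasing[of 0 1 g])
    fix t :: real assume "0 \<le> t" "t \<le> 1"
    have "inner (J' (x + t *\<^sub>R d) - J' x) d \<le> norm (J' (x + t *\<^sub>R d) - J' x) * norm d"
      by (rule norm_cauchy_schwarz)
    also have "\<dots> \<le> L * norm (t *\<^sub>R d) * norm d"
      using gradient_lipschitz[of "x + t *\<^sub>R d" x] by (intro mult_right_mono) auto
    also have "\<dots> = L * t * (norm d)\<^sup>2"
      using \<open>0 \<le> t\<close> by (simp add: power2_eq_square)
    finally show "\<exists>y. DERIV g t :> y \<and> y \<le> 0" using deriv[of t] by auto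
  qed simp
  then show ?thesis by (simp add: g_def d_def)
qed

section \<open>Penalized functionals and their minimizers\<close>

definition penalized :: "real \<Rightarrow> 'a \<Rightarrow> real" where
  "penalized \<tau> x = 1 / 2 * (norm (x - x0))\<^sup>2 - \<tau> * J x"

text \<open>At a critical point the first-order terms cancel, and the convexity \<open>1\<close> of the penalty outweighs
  the concavity \<open>\<tau> * L\<close> that \<open>- \<tau> * J\<close> may contribute. For \<open>\<tau> < 1 / L\<close> the minimum is strict; for
  \<open>\<tau> = 1 / L\<close> critical points are still global minima.\<close>

lemma penalized_gap:
  assumes crit: "x = x0 + \<tau> *\<^sub>R J' x" and "0 \<le> \<tau>"
  shows "penalized \<tau> x + (1 - \<tau> * L) / 2 * (norm (y - x))\<^sup>2 \<le> penalized \<tau> y"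
proof -
  have "(norm (y - x0))\<^sup>2 = (norm ((y - x) + (x - x0)))\<^sup>2" by simp
  also have "\<dots> = (norm (y - x))\<^sup>2 + 2 * inner (y - x) (x - x0) + (norm (x - x0))\<^sup>2"
    by (simp only: power2_norm_eq_inner inner_add_left inner_add_right inner_commute)
  also have "x - x0 = \<tau> *\<^sub>R J' x" using crit by (metis add_diff_cancel_left')
  finally have sq: "(norm (y - x0))\<^sup>2
      = (norm (y - x))\<^sup>2 + 2 * \<tau> * inner (J' x) (y - x) + (norm (x - x0))\<^sup>2"
    using \<open>x - x0 = \<tau> *\<^sub>R J' x\<close> by (simp add: inner_commute)
  have "\<tau> * J y \<le> \<tau> * (J x + inner (J' x) (y - x) + L / 2 * (norm (y - x))\<^sup>2)"
    using quadratic_upper_bound \<open>0 \<le> \<tau>\<close> by (rule mult_left_mono)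
  then show ?thesis unfolding penalized_def sq by (simp add: field_simps)
qed

text \<open>Adding the two minimality inequalities cancels the penalty and leaves
  \<open>(\<mu> - \<tau>) * (J y - J x) \<ge> 0\<close>.\<close>

lemma global_minima_penalized_mono:
  assumes x: "x \<in> global_minima (penalized \<tau>)" and y: "y \<in> global_minima (penalized \<mu>)"
    and "0 \<le> \<tau>" "\<tau> < \<mu>"
  shows "J x \<le> J y" "norm (x - x0) \<le> norm (y - x0)"
proof -
  have 1: "penalized \<tau> x \<le> penalized \<tau> y" and 2: "penalized \<mu> y \<le> penalized \<mu> x"
    using x y by (auto simp: global_minima_def)
  then have "0 \<le> (\<mu> - \<tau>) * (J y - J x)" unfolding penalized_def by (simp add: algebra_simps)
  then show *: "J x \<le> J y" using \<open>\<tau> < \<mu>\<close> by (simp add: zero_le_mult_iff)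
  have "\<tau> * J x \<le> \<tau> * J y" using * \<open>0 \<le> \<tau>\<close> by (rule mult_left_mono)
  with 1 have "(norm (x - x0))\<^sup>2 \<le> (norm (y - x0))\<^sup>2" unfolding penalized_def by linarith
  then show "norm (x - x0) \<le> norm (y - x0)" by (rule power2_le_imp_le) simp
qed

text \<open>Uniqueness of the critical point, which makes this description meaningful, holds for
  \<open>0 \<le> \<tau> < 1 / L\<close>; nothing is claimed outside this range.\<close>

definition branch :: "real \<Rightarrow> 'a" where
  "branch \<tau> = (THE x. x = x0 + \<tau> *\<^sub>R J' x)"

lemma branch_critical:
  assumes "0 \<le> \<tau>" "\<tau> < 1 / L"
  shows "branch \<tau> = x0 + \<tau> *\<^sub>R J' (branch \<tau>)"
proof -
  have "\<exists>!x. x0 + \<tau> *\<^sub>R J' x = x"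
  proof (rule banach_fix_type)
    show "0 \<le> \<tau> * L" "\<tau> * L < 1" using assms L_pos by (auto simp: field_simps)
    show "\<forall>x y. dist (x0 + \<tau> *\<^sub>R J' x) (x0 + \<tau> *\<^sub>R J' y) \<le> \<tau> * L * dist x y"
    proof (intro allI)
      fix x y
      have "dist (x0 + \<tau> *\<^sub>R J' x) (x0 + \<tau> *\<^sub>R J' y) = \<tau> * norm (J' x - J' y)"
        using assms by (simp add: dist_norm flip: scaleR_diff_right)
      also have "\<dots> \<le> \<tau> * (L * norm (x - y))"
        using gradient_lipschitz assms by (intro mult_left_mono) auto
      finally show "dist (x0 + \<tau> *\<^sub>R J' x) (x0 + \<tau> *\<^sub>R J' y) \<le> \<tau> * L * dist x y"
        by (simp add: dist_norm)
    qed
  qed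
  then have "\<exists>!x. x = x0 + \<tau> *\<^sub>R J' x" by metis
  then show ?thesis unfolding branch_def by (rule theI')
qed

lemma branch_0 [simp]: "branch 0 = x0"
  using branch_critical[of 0] L_pos by simp

lemma branch_strict_min:
  assumes "0 \<le> \<tau>" "\<tau> < 1 / L" "y \<noteq> branch \<tau>"
  shows "penalized \<tau> (branch \<tau>) < penalized \<tau> y"
proof -
  have "0 < (1 - \<tau> * L) / 2 * (norm (y - branch \<tau>))\<^sup>2"
    using assms L_pos by (simp add: field_simps)
  with penalized_gap[OF branch_critical, of \<tau> y] assms show ?thesis by auto
qed

lemma branch_in_global_minima:
  assumes "0 \<le> \<tau>" "\<tau> < 1 / L"
  shows "branch \<tau> \<in> global_minima (penalized \<tau>)"
  unfolding global_minima_def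
proof (intro CollectI allI)
  show "penalized \<tau> (branch \<tau>) \<le> penalized \<tau> y" for y
    using branch_strict_min[OF assms, of y] by (cases "y = branch \<tau>") auto
qed

text \<open>The two constrained problems solved by a branch point: at a fixed level of \<open>J\<close>
  only the distance to \<open>x0\<close> influences the penalized value, and on a fixed sphere only \<open>J\<close> does.\<close>

lemma branch_nearest_on_level:
  assumes "0 \<le> \<tau>" "\<tau> < 1 / L" "J y = J (branch \<tau>)" "y \<noteq> branch \<tau>"
  shows "norm (branch \<tau> - x0) < norm (y - x0)"
proof -
  have "(norm (branch \<tau> - x0))\<^sup>2 < (norm (y - x0))\<^sup>2"
    using branch_strict_min[OF assms(1,2,4)] assms(3) by (simp add: penalized_def)
  then show ?thesis by (rule power2_less_imp_less) simp
qed

lemma branch_highest_on_sphere: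
  assumes "0 < \<tau>" "\<tau> < 1 / L" "norm (y - x0) = norm (branch \<tau> - x0)" "y \<noteq> branch \<tau>"
  shows "J y < J (branch \<tau>)"
  using branch_strict_min[of \<tau> y] assms by (simp add: penalized_def)

section \<open>The curve of minimizers\<close>

lemma branch_leaves_start:
  assumes "0 < \<tau>" "\<tau> < 1 / L" "J' x0 \<noteq> 0"
  shows "0 < norm (branch \<tau> - x0)" "J x0 < J (branch \<tau>)"
proof -
  have ne: "branch \<tau> \<noteq> x0"
    using branch_critical[of \<tau>] assms by auto
  then show "0 < norm (branch \<tau> - x0)" by simp
  have "penalized \<tau> (branch \<tau>) < penalized \<tau> x0"
    using branch_strict_min[of \<tau> x0] ne assms by auto
  then have "1 / 2 * (norm (branch \<tau> - x0))\<^sup>2 < \<tau> * (J (branch \<tau>) - J x0)"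
    unfolding penalized_def by (simp add: algebra_simps)
  then have "0 < \<tau> * (J (branch \<tau>) - J x0)"
    using zero_le_power2[of "norm (branch \<tau> - x0)"] by linarith
  then show "J x0 < J (branch \<tau>)" using assms by (simp add: zero_less_mult_iff)
qed

lemma branch_dist_le:
  assumes "0 \<le> \<tau>" "\<tau> < 1 / L" "0 \<le> \<mu>" "\<mu> < 1 / L"
  shows "(1 - \<tau> * L) * norm (branch \<tau> - branch \<mu>) \<le> \<bar>\<tau> - \<mu>\<bar> * norm (J' (branch \<mu>))"
proof -
  let ?x = "branch \<tau>" and ?y = "branch \<mu>"
  have "?x - ?y = (x0 + \<tau> *\<^sub>R J' ?x) - (x0 + \<mu> *\<^sub>R J' ?y)"
    using branch_critical assms by metis
  also have "\<dots> = \<tau> *\<^sub>R (J' ?x - J' ?y) + (\<tau> - \<mu>) *\<^sub>R J' ?y"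
    by (simp add: algebra_simps)
  finally have "norm (?x - ?y) \<le> \<tau> * norm (J' ?x - J' ?y) + \<bar>\<tau> - \<mu>\<bar> * norm (J' ?y)"
    using norm_triangle_ineq[of "\<tau> *\<^sub>R (J' ?x - J' ?y)" "(\<tau> - \<mu>) *\<^sub>R J' ?y"] assms by simp
  moreover have "\<tau> * norm (J' ?x - J' ?y) \<le> \<tau> * (L * norm (?x - ?y))"
    using gradient_lipschitz assms by (intro mult_left_mono) auto
  ultimately show ?thesis by (simp add: algebra_simps)
qed

lemma continuous_on_branch: "continuous_on {0..<1 / L} branch"
  unfolding continuous_on_def
proof
  fix \<mu> assume \<mu>: "\<mu> \<in> {0..<1 / L}"
  let ?F = "at \<mu> within {0..<1 / L}"
  let ?g = "\<lambda>\<tau>. \<bar>\<tau> - \<mu>\<bar> * norm (J' (branch \<mu>)) / (1 - \<tau> * L)"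
  have "1 - \<mu> * L \<noteq> 0" using \<mu> L_pos by (auto simp: field_simps)
  then have "(?g \<longlongrightarrow> \<bar>\<mu> - \<mu>\<bar> * norm (J' (branch \<mu>)) / (1 - \<mu> * L)) ?F"
    by (intro tendsto_intros)
  then have "(?g \<longlongrightarrow> 0) ?F" by simp
  moreover have "\<forall>\<^sub>F \<tau> in ?F. norm (branch \<tau> - branch \<mu>) \<le> ?g \<tau>"
    unfolding eventually_at_filter
  proof (intro always_eventually allI impI)
    fix \<tau> assume \<tau>: "\<tau> \<in> {0..<1 / L}"
    then have "0 < 1 - \<tau> * L" using L_pos by (auto simp: field_simps)
    with branch_dist_le[of \<tau> \<mu>] \<tau> \<mu> show "norm (branch \<tau> - branch \<mu>) \<le> ?g \<tau>"
      by (simp add: pos_le_divide_eq mult.commute)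
  qed
  ultimately have "((\<lambda>\<tau>. branch \<tau> - branch \<mu>) \<longlongrightarrow> 0) ?F"
    by (rule Lim_null_comparison[rotated])
  then show "(branch \<longlongrightarrow> branch \<mu>) ?F" by (simp add: LIM_zero_iff)
qed

lemma branch_intermediate_value:
  assumes g: "continuous_on UNIV g" "g x0 < r"
    and \<mu>: "0 < \<mu>" "\<mu> < 1 / L" "r < g (branch \<mu>)"
  shows "\<exists>\<tau>. 0 < \<tau> \<and> \<tau> < 1 / L \<and> g (branch \<tau>) = (r::real)"
proof -
  have "continuous_on {0..\<mu>} (\<lambda>\<tau>. g (branch \<tau>))"
    using \<mu> by (intro continuous_on_compose2[OF g(1)] continuous_on_subset[OF continuous_on_branch]) auto
  then obtain \<tau> where "0 \<le> \<tau>" "\<tau> \<le> \<mu>" "g (branch \<tau>) = r"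
    using IVT'[of "\<lambda>\<tau>. g (branch \<tau>)" 0 r \<mu>] g \<mu> by auto
  with g(2) \<mu> show ?thesis by (intro exI[of _ \<tau>]) (auto simp: less_le)
qed

text \<open>With \<open>u\<^sub>\<tau> = branch \<tau> - x0\<close> we have \<open>J' (branch \<tau>) = u\<^sub>\<tau> / \<tau>\<close>, so the one-sided
  Lipschitz bound on \<open>J'\<close> between the points for \<open>\<tau>\<close> and \<open>\<mu>\<close> says that
  \<open>(1/\<tau> - 1/\<mu>) * \<langle>u\<^sub>\<tau>, u\<^sub>\<mu> - u\<^sub>\<tau>\<rangle> \<ge> (1/\<mu> - L) * \<parallel>u\<^sub>\<mu> - u\<^sub>\<tau>\<parallel>\<^sup>2 \<ge> 0\<close>. A nonnegative inner product is
  the claim. It turns convergence of the distances to \<open>x0\<close> into norm convergence of the points,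
  uniformly up to \<open>1 / L\<close>, where the contraction estimate degenerates.\<close>

lemma branch_obtuse:
  assumes "0 < \<tau>" "\<tau> \<le> \<mu>" "\<mu> < 1 / L"
  shows "(norm (branch \<mu> - branch \<tau>))\<^sup>2 \<le> (norm (branch \<mu> - x0))\<^sup>2 - (norm (branch \<tau> - x0))\<^sup>2"
proof (cases "\<tau> = \<mu>")
  case False
  then have "\<tau> < \<mu>" using assms by simp
  define u where "u = branch \<tau> - x0"
  define d where "d = branch \<mu> - branch \<tau>"
  have "u = \<tau> *\<^sub>R J' (branch \<tau>)" "u + d = \<mu> *\<^sub>R J' (branch \<mu>)"
    using branch_critical[of \<tau>] branch_critical[of \<mu>] assms by (auto simp: u_def d_def algebra_simps)
  then have grad: "J' (branch \<tau>) = (1 / \<tau>) *\<^sub>R u" "J' (branch \<mu>) = (1 / \<mu>) *\<^sub>R (u + d)"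
    using assms by auto
  have "inner ((1 / \<mu>) *\<^sub>R (u + d) - (1 / \<tau>) *\<^sub>R u) d \<le> L * (norm d)\<^sup>2"
    using gradient_inner_le[of "branch \<mu>" "branch \<tau>"] by (simp add: grad flip: d_def)
  then have "(1 / \<mu> - L) * (norm d)\<^sup>2 \<le> (1 / \<tau> - 1 / \<mu>) * inner u d"
    by (simp add: inner_diff_left inner_add_left power2_norm_eq_inner algebra_simps add_divide_distrib)
  moreover have "0 \<le> (1 / \<mu> - L) * (norm d)\<^sup>2"
    using assms L_pos by (intro mult_nonneg_nonneg) (auto simp: field_simps)
  ultimately have "0 \<le> (1 / \<tau> - 1 / \<mu>) * inner u d" by linarith
  moreover have "0 < 1 / \<tau> - 1 / \<mu>" using assms \<open>\<tau> < \<mu>\<close> by (simp add: field_simps)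
  ultimately have "0 \<le> inner u d" by (simp add: zero_le_mult_iff)
  moreover have "(norm (u + d))\<^sup>2 = (norm u)\<^sup>2 + 2 * inner u d + (norm d)\<^sup>2"
    by (simp add: power2_norm_eq_inner inner_add_left inner_add_right inner_commute)
  ultimately have "(norm d)\<^sup>2 \<le> (norm (u + d))\<^sup>2 - (norm u)\<^sup>2" by simp
  then show ?thesis by (simp add: u_def d_def)
qed simp

lemma branch_unbounded_or_limit:
  obtains (unbounded) "\<And>K. \<exists>\<tau>. 0 < \<tau> \<and> \<tau> < 1 / L \<and> K < norm (branch \<tau> - x0)"
  | (limit) \<tau> x where "\<And>n. 0 < \<tau> n" "\<And>n. \<tau> n < 1 / L" "(\<lambda>n::nat. branch (\<tau> n)) \<longlonglongrightarrow> x"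
      "x \<in> global_minima (penalized (1 / L))"
proof (cases "\<exists>K. \<forall>\<tau>. 0 < \<tau> \<and> \<tau> < 1 / L \<longrightarrow> norm (branch \<tau> - x0) \<le> K")
  case False
  then show thesis using unbounded by (meson not_le)
next
  case True
  then obtain K where K: "\<And>\<tau>. 0 < \<tau> \<Longrightarrow> \<tau> < 1 / L \<Longrightarrow> norm (branch \<tau> - x0) \<le> K" by blast
  \<comment> \<open>Parameters increasing to \<open>1 / L\<close>; starting at \<open>1 - 1/2\<close> keeps all of them positive.\<close>
  define l where "l n = (1 - inverse (real (Suc (Suc n)))) / L" for n
  have l_pos: "0 < l n" and l_less: "l n < 1 / L" for n
    using L_pos by (auto simp: l_def divide_less_cancel inverse_less_1_iff)
  have l_mono: "l m \<le> l n" if "m \<le> n" for m n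
    using that L_pos unfolding l_def by (intro divide_right_mono) (auto intro!: le_imp_inverse_le)
  define N where "N n = (norm (branch (l n) - x0))\<^sup>2" for n
  have obtuse: "(norm (branch (l n) - branch (l m)))\<^sup>2 \<le> N n - N m" if "m \<le> n" for m n
    unfolding N_def using branch_obtuse[OF l_pos l_mono[OF that] l_less] .
  have "incseq N"
    using obtuse by (intro monoI) (smt (verit) zero_le_power2)
  moreover have "N n \<le> K\<^sup>2" for n
    unfolding N_def using K[OF l_pos l_less] by (intro power_mono) auto
  ultimately have "convergent N"
    unfolding convergent_def by (meson incseq_convergent)
  then have "Cauchy N" by (rule convergent_Cauchy)
  have "Cauchy (\<lambda>n. branch (l n))"
  proof (rule CauchyI')
    fix e :: real assume "0 < e"
    then obtain M where M: "\<And>m n. M \<le> m \<Longrightarrow> M \<le> n \<Longrightarrow> norm (N m - N n) < e\<^sup>2"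
      using CauchyD[OF \<open>Cauchy N\<close>, of "e\<^sup>2"] by auto
    show "\<exists>M. \<forall>m\<ge>M. \<forall>n>m. dist (branch (l m)) (branch (l n)) < e"
    proof (intro exI allI impI)
      fix m n assume "M \<le> m" "m < n"
      have "(norm (branch (l n) - branch (l m)))\<^sup>2 \<le> N n - N m"
        using \<open>m < n\<close> by (intro obtuse) simp
      also have "\<dots> < e\<^sup>2" using M[of n m] \<open>M \<le> m\<close> \<open>m < n\<close> by simp
      finally have "norm (branch (l n) - branch (l m)) < e"
        by (rule power2_less_imp_less) (use \<open>0 < e\<close> in simp)
      then show "dist (branch (l m)) (branch (l n)) < e" by (simp add: dist_norm norm_minus_commute)
    qed
  qed
  then obtain x where x: "(\<lambda>n. branch (l n)) \<longlonglongrightarrow> x"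
    using Cauchy_convergent convergent_def by blast
  have "l \<longlonglongrightarrow> (1 - 0) / L"
    unfolding l_def using L_pos
    by (intro tendsto_intros LIMSEQ_Suc[OF LIMSEQ_inverse_real_of_nat]) auto
  moreover have "(\<lambda>n. J' (branch (l n))) \<longlonglongrightarrow> J' x"
    by (rule continuous_on_tendsto_compose[OF continuous_on_gradient[of UNIV] x]) auto
  ultimately have "(\<lambda>n. x0 + l n *\<^sub>R J' (branch (l n))) \<longlonglongrightarrow> x0 + (1 / L) *\<^sub>R J' x"
    unfolding diff_zero by (intro tendsto_intros)
  moreover have "x0 + l n *\<^sub>R J' (branch (l n)) = branch (l n)" for n
    using branch_critical[of "l n"] l_pos[of n] l_less[of n] by simp
  ultimately have "(\<lambda>n. branch (l n)) \<longlonglongrightarrow> x0 + (1 / L) *\<^sub>R J' x"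
    by simp
  then have "x = x0 + (1 / L) *\<^sub>R J' x" by (rule LIMSEQ_unique[OF x])
  then have "x \<in> global_minima (penalized (1 / L))"
    using penalized_gap[of x "1 / L"] L_pos by (auto simp: global_minima_def)
  with l_pos l_less x show thesis by (rule limit)
qed

section \<open>Levels and radii reached by the curve\<close>

lemma branch_exceeds_level:
  assumes "ereal r < (INF x\<in>global_minima (penalized (1 / L)). ereal (J x))"
  shows "\<exists>\<tau>. 0 < \<tau> \<and> \<tau> < 1 / L \<and> r < J (branch \<tau>)"
proof (cases rule: branch_unbounded_or_limit)
  case unbounded
  \<comment> \<open>If \<open>J (branch \<tau>) \<le> r\<close>, then minimality against \<open>x0\<close> and \<open>\<tau> < 1 / L\<close> bound the squared distance
    by \<open>2 * \<bar>r - J x0\<bar> / L\<close>; the summand \<open>1\<close> below only avoids a square root.\<close>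
  define B where "B = 1 + 2 * \<bar>r - J x0\<bar> / L"
  obtain \<tau> where \<tau>: "0 < \<tau>" "\<tau> < 1 / L" "B < norm (branch \<tau> - x0)"
    using unbounded[of B] by blast
  have "1 \<le> B" using L_pos by (simp add: B_def)
  have "B \<le> B\<^sup>2" using \<open>1 \<le> B\<close> by (simp add: power2_eq_square)
  also have "B\<^sup>2 < (norm (branch \<tau> - x0))\<^sup>2"
    using \<tau> \<open>1 \<le> B\<close> by (intro power_strict_mono) auto
  also have "\<dots> \<le> 2 * (\<tau> * (J (branch \<tau>) - J x0))"
    using branch_in_global_minima[of \<tau>] \<tau>
    by (auto simp: global_minima_def penalized_def algebra_simps dest!: spec[of _ x0])
  finally have *: "B < 2 * (\<tau> * (J (branch \<tau>) - J x0))" .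
  have "r < J (branch \<tau>)"
  proof (rule ccontr)
    assume "\<not> r < J (branch \<tau>)"
    then have "\<tau> * (J (branch \<tau>) - J x0) \<le> \<tau> * \<bar>r - J x0\<bar>"
      using \<tau> by (intro mult_left_mono) auto
    also have "\<dots> \<le> 1 / L * \<bar>r - J x0\<bar>"
      using \<tau> by (intro mult_right_mono) auto
    finally show False using * by (simp add: B_def)
  qed
  with \<tau> show ?thesis by blast
next
  case (limit \<tau> x)
  have "r < J x"
    using assms INF_lower[OF limit(4), of "\<lambda>x. ereal (J x)"] by (metis less_ereal.simps(1) less_le_trans)
  moreover have "(\<lambda>n. J (branch (\<tau> n))) \<longlonglongrightarrow> J x"
    by (rule continuous_on_tendsto_compose[OF continuous_on_J[of UNIV] limit(3)]) auto
  ultimately have "\<forall>\<^sub>F n in sequentially. r < J (branch (\<tau> n))"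
    by (intro order_tendstoD(1))
  then obtain n where "r < J (branch (\<tau> n))"
    using eventually_happens'[OF sequentially_bot] by blast
  with limit(1,2) show ?thesis by blast
qed

lemma branch_exceeds_radius:
  assumes "ereal r < edist_set x0 (global_minima (penalized (1 / L)))"
  shows "\<exists>\<tau>. 0 < \<tau> \<and> \<tau> < 1 / L \<and> r < norm (branch \<tau> - x0)"
proof (cases rule: branch_unbounded_or_limit)
  case unbounded
  then show ?thesis by blast
next
  case (limit \<tau> x)
  have "r < norm (x - x0)"
    using assms INF_lower[OF limit(4), of "\<lambda>x. ereal (norm (x0 - x))"] unfolding edist_set_def
    by (metis less_ereal.simps(1) less_le_trans norm_minus_commute)
  moreover have "(\<lambda>n. norm (branch (\<tau> n) - x0)) \<longlonglongrightarrow> norm (x - x0)"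
    by (intro tendsto_intros limit(3))
  ultimately have "\<forall>\<^sub>F n in sequentially. r < norm (branch (\<tau> n) - x0)"
    by (intro order_tendstoD(1))
  then obtain n where "r < norm (branch (\<tau> n) - x0)"
    using eventually_happens'[OF sequentially_bot] by blast
  with limit(1,2) show ?thesis by blast
qed

text \<open>Any parameter strictly between \<open>0\<close> and \<open>1 / L\<close> yields a separating point; the midpoint is an
  arbitrary choice.\<close>

lemma start_below_global_minima:
  assumes "J' x0 \<noteq> 0"
  shows "ereal (J x0) < (INF x\<in>global_minima (penalized (1 / L)). ereal (J x))"
    and "0 < edist_set x0 (global_minima (penalized (1 / L)))"
proof -
  define \<tau> where "\<tau> = 1 / (2 * L)"
  have \<tau>: "0 < \<tau>" "\<tau> < 1 / L" using L_pos by (auto simp: \<tau>_def field_simps)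
  note mono = global_minima_penalized_mono[OF branch_in_global_minima _ _ \<tau>(2)]
  have "ereal (J x0) < ereal (J (branch \<tau>))"
    using branch_leaves_start(2)[OF \<tau> assms] by simp
  also have "\<dots> \<le> (INF x\<in>global_minima (penalized (1 / L)). ereal (J x))"
    using mono(1) \<tau> by (auto intro!: INF_greatest)
  finally show "ereal (J x0) < (INF x\<in>global_minima (penalized (1 / L)). ereal (J x))" .
  have "0 < ereal (norm (branch \<tau> - x0))"
    using branch_leaves_start(1)[OF \<tau> assms] by simp
  also have "\<dots> \<le> edist_set x0 (global_minima (penalized (1 / L)))"
    unfolding edist_set_def using mono(2) \<tau>
    by (auto intro!: INF_greatest simp: norm_minus_commute[of x0])
  finally show "0 < edist_set x0 (global_minima (penalized (1 / L)))" .
qed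

lemma unique_nearest_on_level:
  assumes "J x0 < r" "ereal r < (INF x\<in>global_minima (penalized (1 / L)). ereal (J x))"
  shows "\<exists>!y. y \<in> J -` {r} \<and> ereal (norm (x0 - y)) = edist_set x0 (J -` {r})"
proof -
  obtain \<tau> where \<tau>: "0 < \<tau>" "\<tau> < 1 / L" "J (branch \<tau>) = r"
    using branch_exceeds_level[OF assms(2)]
      branch_intermediate_value[OF continuous_on_J assms(1)] by blast
  have nearest: "norm (x0 - branch \<tau>) < norm (x0 - y)" if "J y = r" "y \<noteq> branch \<tau>" for y
    using branch_nearest_on_level[of \<tau> y] that \<tau> by (simp add: norm_minus_commute)
  show ?thesis
  proof (intro ex1I[of _ "branch \<tau>"] conjI)
    show mem: "branch \<tau> \<in> J -` {r}" using \<tau> by simp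
    show "ereal (norm (x0 - branch \<tau>)) = edist_set x0 (J -` {r})"
      unfolding edist_set_attained_iff[OF mem] using nearest by fastforce
    fix y assume y: "y \<in> J -` {r} \<and> ereal (norm (x0 - y)) = edist_set x0 (J -` {r})"
    then have "norm (x0 - y) \<le> norm (x0 - branch \<tau>)"
      using edist_set_attained_iff[of y "J -` {r}" x0] mem by blast
    with nearest[of y] y show "y = branch \<tau>" by fastforce
  qed
qed

lemma unique_maximum_on_sphere:
  assumes "0 < r" "ereal r < edist_set x0 (global_minima (penalized (1 / L)))"
  shows "\<exists>!x. x \<in> sphere x0 r \<and> (\<forall>y\<in>sphere x0 r. J y \<le> J x)"
proof -
  have "continuous_on UNIV (\<lambda>x. norm (x - x0))" by (intro continuous_intros)
  then obtain \<tau> where \<tau>: "0 < \<tau>" "\<tau> < 1 / L" "norm (branch \<tau> - x0) = r"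
    using branch_exceeds_radius[OF assms(2)]
      branch_intermediate_value[of "\<lambda>x. norm (x - x0)" r] assms(1) by auto
  have highest: "J y < J (branch \<tau>)" if "y \<in> sphere x0 r" "y \<noteq> branch \<tau>" for y
    using branch_highest_on_sphere[of \<tau> y] that \<tau> by (simp add: dist_norm norm_minus_commute)
  have mem: "branch \<tau> \<in> sphere x0 r" using \<tau> by (simp add: dist_norm norm_minus_commute)
  show ?thesis
  proof (intro ex1I[of _ "branch \<tau>"] conjI ballI mem)
    show "J y \<le> J (branch \<tau>)" if "y \<in> sphere x0 r" for y
      using highest[OF that] by fastforce
    show "y = branch \<tau>" if "y \<in> sphere x0 r \<and> (\<forall>z\<in>sphere x0 r. J z \<le> J y)" for y
      using highest[of y] that mem by fastforce
  qed
qed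

end

section \<open>Nearest points of level sets and maxima on spheres\<close>

theorem theorem1:
  fixes J :: "'a::{real_inner, complete_space} \<Rightarrow> real"
    and J' :: "'a \<Rightarrow> 'a"
    and L :: real
    and x0 :: 'a
    and M :: "'a set"
    and \<alpha>0 \<beta>0 :: ereal
  assumes "seq_weakly_usc J"
    and "\<And>x. GDERIV J x :> J' x"
    and "continuous_on UNIV J'"
    and "\<exists>C. C-lipschitz_on UNIV J'"
    and "L = lipschitz_constant J'"
    and "L > 0"
    and "J' x0 \<noteq> 0"
    and "M = global_minima (\<lambda>x. 1 / 2 * (norm (x - x0))\<^sup>2 - 1 / L * J x)"
    and "\<alpha>0 = (INF x\<in>M. ereal (J x))"
    and "\<beta>0 = edist_set x0 M"
  shows "\<alpha>0 > ereal (J x0) \<and> \<beta>0 > 0 \<and>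
    (\<forall>r::real. J x0 < r \<and> ereal r < \<alpha>0 \<longrightarrow>
       (\<exists>!y. y \<in> J -` {r} \<and> ereal (norm (x0 - y)) = edist_set x0 (J -` {r}))) \<and>
    (\<forall>r::real. 0 < r \<and> ereal r < \<beta>0 \<longrightarrow>
       (\<exists>!x. x \<in> sphere x0 r \<and> (\<forall>y\<in>sphere x0 r. J y \<le> J x)))"
proof -
  have "L-lipschitz_on UNIV J'"
    using assms(4,5) lipschitz_on_lipschitz_constant by blast
  with assms(2,6) interpret lipschitz_gradient J J' L x0
    by unfold_locales auto
  have M: "M = global_minima (penalized (1 / L))"
    using assms(8) by (simp add: penalized_def[abs_def])
  show ?thesis
    unfolding assms(9,10) M
    using start_below_global_minima[OF assms(7)] unique_nearest_on_level unique_maximum_on_sphere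
    by blast
qed

end
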